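(* Let $q$ be a prime power, let $n \geq 4$ and let $0 \leq h \leq n$ be integers. Then $$\frac{1}{q^n} \sum_{A \in \mathcal{M}_n} \lvert \Delta (A;h) \rvert^2 = \begin{cases} (q-1) q^{h-1} \dfrac{(n-2h-1)(n-2h)(n-2h+1)}{6} & \text{if } h \leq \lfloor \frac{n}{2} \rfloor -1, \\ 0 & \text{if } h \geq \lfloor \frac{n}{2} \rfloor . \end{cases}$$
   Context: $\mathcal{M}_n$ is the set of monic polynomials of degree $n$ in $\mathbb{F}_q[T]$, and $\mathcal{M}$ is the set of all monic polynomials in $\mathbb{F}_q[T]$. For $N \in \mathcal{M}$, $d(N)$ is the number of pairs $(A_1,A_2) \in \mathcal{M}^2$ with $A_1A_2 = N$ (the number of monic divisors of $N$). Convention: $\deg 0 = -\infty$. For $A \in \mathcal{M}_n$ and $0 \leq h \leq n$, let $I(A;h) := \{ B \in \mathcal{M} : \deg (B-A) < h \}$ and $$\Delta (A;h) := \sum_{B \in I(A;h)} d(B) \; - \; q^h (n+1).$$ *)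

theory Defs
  imports
    Complex_Main
    "HOL-Computational_Algebra.Polynomial"
    "HOL-Library.Cardinality"
    "HOL-Library.Extended_Real"
begin

(* The finite field F_q is a type 'a of class {field, finite} with CARD('a) = q. *)

definition monic_polys :: "'a::{field, finite} poly set" where
  "monic_polys = {A. lead_coeff A = 1}"

definition monic_polys_deg :: "nat \<Rightarrow> 'a::{field, finite} poly set" where
  "monic_polys_deg n = {A \<in> monic_polys. degree A = n}"

(* The library has degree 0 = 0; here deg 0 = - infinity, which matters for
   short_interval A 0 = {A}. *)
definition deg :: "'a::zero poly \<Rightarrow> ereal" where
  "deg A = (if A = 0 then - \<infinity> else ereal (real (degree A)))"

definition num_monic_divisors :: "'a::{field, finite} poly \<Rightarrow> nat" where
  "num_monic_divisors N =
     card {(A1, A2). A1 \<in> monic_polys \<and> A2 \<in> monic_polys \<and> A1 * A2 = N}"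

definition short_interval :: "'a::{field, finite} poly \<Rightarrow> nat \<Rightarrow> 'a poly set" where
  "short_interval A h = {B \<in> monic_polys. deg (B - A) < ereal (real h)}"

definition Delta :: "'a::{field, finite} poly \<Rightarrow> nat \<Rightarrow> real" where
  "Delta A h =
     (\<Sum>B\<in>short_interval A h. real (num_monic_divisors B))
       - real CARD('a) ^ h * (real (degree A) + 1)"

end

theory Submission
  imports Defs
begin

text \<open>
  Sort the divisor pairs \<open>(X, Y)\<close> with product in \<open>I(A; h)\<close> by \<open>a = degree X\<close>, and let
  \<open>S a A\<close> be the number of those with first degree \<open>a\<close>. Each \<open>S a\<close> has mean
  \<open>q ^ h\<close> over the monic \<open>A\<close> of degree \<open>n\<close>, and so \<open>Delta A h\<close> is the sum over \<open>a \<le> n\<close> of the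
  fluctuations \<open>S a A - q ^ h\<close> (\<open>Delta_eq_sum\<close>). The mean square of \<open>Delta\<close> is therefore the sum of all
  covariances, and these have a simple closed form: the covariance of \<open>S a\<close> and \<open>S b\<close> is
  \<open>q ^ h * (1 - 1 / q)\<close> times the positive part of \<open>m - h\<close>, where \<open>m\<close> is the least of
  \<open>a\<close>, \<open>b\<close>, \<open>n - a\<close> and \<open>n - b\<close> (\<open>covariance_near_factorizations\<close>).

  To see this, note that \<open>S a A * S b A\<close>, summed over \<open>A\<close>, is \<open>q ^ h\<close> times the number of
  quadruples \<open>(X, Y, X', Y')\<close> with \<open>deg (X * Y - X' * Y') < h\<close>. By symmetry one may assume
  \<open>a + b \<le> n\<close>. For fixed \<open>X\<close> and \<open>X'\<close> whose gcd has degree \<open>g\<close>, solving the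
  linear congruence for \<open>Y\<close> and \<open>Y'\<close> gives exactly \<open>q ^ (n - a - b + max h g)\<close> solutions
  (\<open>card_near_equal_multiples\<close>). The gcd in turn has degree at least \<open>k\<close> for exactly
  \<open>q ^ (a + b - k)\<close> of the pairs, whenever \<open>k \<le> min a b\<close> (\<open>card_pairs_gcd_degree_ge\<close>), and
  summation by parts produces a term linear in \<open>min a b - h\<close> (\<open>sum_power_max_gcd_degree\<close>).

  Finally, the sum over \<open>a\<close> and \<open>b\<close> of the positive part of \<open>m - h\<close> is, by
  layers, the sum of the squares \<open>(n - 2 * h - 1)\<^sup>2 + (n - 2 * h - 3)\<^sup>2 + \<dots>\<close> with positive
  bases; for \<open>2 * h \<le> n\<close> this is the binomial
  coefficient of \<open>n - 2 * h + 1\<close> over \<open>3\<close> (\<open>sum_min_distance_excess\<close>).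
\<close>

section \<open>Monic polynomials and polynomials of low degree\<close>

text \<open>
  The condition \<open>deg C < h\<close>, with \<open>deg 0 = - \<infinity>\<close>, is expressed through
  coefficients: this makes the additive structure immediate, and for \<open>h = 0\<close> it leaves only
  the zero polynomial.
\<close>

definition low_polys :: "nat \<Rightarrow> 'a::{field, finite} poly set" where
  "low_polys h = {C. \<forall>i\<ge>h. coeff C i = 0}"

lemma low_polys_iff: "C \<in> low_polys h \<longleftrightarrow> C = 0 \<or> degree C < h"
proof -
  have "degree C < h" if "C \<noteq> 0" "\<forall>i\<ge>h. coeff C i = 0"
    using that by (meson leading_coeff_0_iff not_less)
  thus ?thesis unfolding low_polys_def by (auto intro: coeff_eq_0)
qed

lemma zero_in_low_polys [simp]: "0 \<in> low_polys h"
  by (simp add: low_polys_def)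

lemma low_polys_diff: "C \<in> low_polys h \<Longrightarrow> D \<in> low_polys h \<Longrightarrow> C - D \<in> low_polys h"
  by (simp add: low_polys_def)

lemma low_polys_mono: "h \<le> n \<Longrightarrow> low_polys h \<subseteq> low_polys n"
  by (auto simp: low_polys_def)

lemma low_polys_Suc:
  "low_polys (Suc h) = (\<lambda>(c, C). pCons c C) ` (UNIV \<times> low_polys h)"
proof (intro equalityI subsetI)
  fix C :: "'a poly" assume "C \<in> low_polys (Suc h)"
  moreover obtain c D where "C = pCons c D" by (cases C) auto
  ultimately have "D \<in> low_polys h"
    unfolding low_polys_def by (auto dest: spec[of _ "Suc _"])
  thus "C \<in> (\<lambda>(c, C). pCons c C) ` (UNIV \<times> low_polys h)"
    using \<open>C = pCons c D\<close> by auto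
next
  fix C :: "'a poly" assume "C \<in> (\<lambda>(c, C). pCons c C) ` (UNIV \<times> low_polys h)"
  thus "C \<in> low_polys (Suc h)"
    by (auto simp: low_polys_def coeff_pCons split: nat.splits)
qed

lemma finite_card_low_polys:
  "finite (low_polys h :: 'a::{field, finite} poly set) \<and>
   card (low_polys h :: 'a poly set) = CARD('a) ^ h"
proof (induction h)
  case 0
  have "low_polys 0 = {0 :: 'a poly}" by (auto simp: low_polys_iff)
  thus ?case by simp
next
  case (Suc h)
  have "inj_on (\<lambda>(c, C :: 'a poly). pCons c C) (UNIV \<times> low_polys h)"
    by (auto simp: inj_on_def)
  with Suc show ?case
    by (simp add: low_polys_Suc card_image card_cartesian_product)
qed

lemmas finite_low_polys [simp] = finite_card_low_polys[THEN conjunct1]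
lemmas card_low_polys = finite_card_low_polys[THEN conjunct2]

lemma monic_polys_deg_iff:
  "A \<in> monic_polys_deg n \<longleftrightarrow> coeff A n = 1 \<and> degree A = n"
  by (auto simp: monic_polys_deg_def monic_polys_def)

lemma monic_polys_deg_nonzero: "A \<in> monic_polys_deg n \<Longrightarrow> A \<noteq> 0"
  by (auto simp: monic_polys_deg_iff)

lemma monic_polys_deg_coeffs:
  "A \<in> monic_polys_deg n \<longleftrightarrow> coeff A n = 1 \<and> (\<forall>i>n. coeff A i = 0)"
  unfolding monic_polys_deg_iff
  by (metis coeff_eq_0 le_degree degree_le le_antisym zero_neq_one)

lemma monic_polys_deg_add_low:
  "A \<in> monic_polys_deg n \<Longrightarrow> C \<in> low_polys n \<Longrightarrow> A + C \<in> monic_polys_deg n"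
  by (simp add: monic_polys_deg_coeffs low_polys_def)

lemma monic_polys_deg_diff_low:
  "A \<in> monic_polys_deg n \<Longrightarrow> C \<in> low_polys n \<Longrightarrow> A - C \<in> monic_polys_deg n"
  by (simp add: monic_polys_deg_coeffs low_polys_def)

lemma monic_polys_deg_diff:
  "A \<in> monic_polys_deg n \<Longrightarrow> B \<in> monic_polys_deg n \<Longrightarrow> A - B \<in> low_polys n"
  unfolding monic_polys_deg_coeffs low_polys_def
  by (auto simp: le_less)

text \<open>
  Subtracting a polynomial of degree below \<open>h \<le> n\<close> touches neither the degree nor the
  leading coefficient, so short intervals inside the monic polynomials of degree \<open>n\<close> are
  full translates of the additive group of low polynomials, of size \<open>q ^ h\<close>.
\<close>

lemma low_neighbours_eq_image:
  assumes "A \<in> monic_polys_deg n" "h \<le> n"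
  shows "{B \<in> monic_polys_deg n. A - B \<in> low_polys h} = (\<lambda>C. A - C) ` low_polys h"
proof (intro equalityI subsetI)
  fix B assume "B \<in> {B \<in> monic_polys_deg n. A - B \<in> low_polys h}"
  thus "B \<in> (\<lambda>C. A - C) ` low_polys h"
    by (intro image_eqI[of _ _ "A - B"]) auto
next
  fix B assume "B \<in> (\<lambda>C. A - C) ` low_polys h"
  thus "B \<in> {B \<in> monic_polys_deg n. A - B \<in> low_polys h}"
    using assms low_polys_mono[of h n] by (auto intro: monic_polys_deg_diff_low)
qed

lemma card_low_neighbours:
  fixes A :: "'a::{field, finite} poly"
  assumes "A \<in> monic_polys_deg n" "h \<le> n"
  shows "card {B \<in> monic_polys_deg n. A - B \<in> low_polys h} = CARD('a) ^ h"
proof -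
  have "inj_on (\<lambda>C. A - C) (low_polys h)" by (simp add: inj_on_def)
  thus ?thesis
    using low_neighbours_eq_image[OF assms] by (simp add: card_image card_low_polys)
qed

lemma monom_in_monic_polys_deg: "monom 1 n \<in> monic_polys_deg n"
  by (simp add: monic_polys_deg_coeffs)

lemma monic_polys_deg_eq_image: "monic_polys_deg n = (\<lambda>C. monom 1 n - C) ` low_polys n"
proof -
  have "monic_polys_deg n = {B \<in> monic_polys_deg n. monom 1 n - B \<in> low_polys n}"
    by (auto intro: monic_polys_deg_diff monom_in_monic_polys_deg)
  also have "\<dots> = (\<lambda>C. monom 1 n - C) ` low_polys n"
    by (rule low_neighbours_eq_image[OF monom_in_monic_polys_deg le_refl])
  finally show ?thesis .
qed

lemma finite_monic_polys_deg [simp]: "finite (monic_polys_deg n)"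
  by (simp add: monic_polys_deg_eq_image)

lemma card_monic_polys_deg:
  "card (monic_polys_deg n :: 'a::{field, finite} poly set) = CARD('a) ^ n"
  by (simp add: monic_polys_deg_eq_image card_image inj_on_def card_low_polys)

lemma monic_polys_deg_mult:
  assumes "A \<in> monic_polys_deg a" "B \<in> monic_polys_deg b"
  shows "A * B \<in> monic_polys_deg (a + b)"
proof -
  have "degree (A * B) = a + b"
    using assms by (auto simp: degree_mult_eq monic_polys_deg_iff monic_polys_deg_nonzero)
  thus ?thesis
    using assms coeff_mult_degree_sum[of A B] by (simp add: monic_polys_deg_iff)
qed

lemma monic_polys_deg_cofactor:
  assumes "A * B \<in> monic_polys_deg n" "A \<in> monic_polys_deg a"
  shows "a \<le> n" "B \<in> monic_polys_deg (n - a)"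
proof -
  have "A \<noteq> 0" "B \<noteq> 0" using assms monic_polys_deg_nonzero by fastforce+
  hence d: "degree (A * B) = a + degree B"
    using assms by (simp add: degree_mult_eq monic_polys_deg_iff)
  hence n: "n = a + degree B" using assms by (simp add: monic_polys_deg_iff)
  thus "a \<le> n" by simp
  have "coeff B (degree B) = 1"
    using coeff_mult_degree_sum[of A B] assms n by (simp add: monic_polys_deg_iff)
  thus "B \<in> monic_polys_deg (n - a)" using n by (simp add: monic_polys_deg_iff)
qed

text \<open>
  If \<open>h \<le> g\<close> then only the zero multiple remains; the truncated subtraction in the exponent
  covers this case.
\<close>

lemma card_low_multiples:
  fixes G :: "'a::{field, finite} poly"
  assumes "G \<in> monic_polys_deg g"
  shows "card {C \<in> low_polys h. G dvd C} = CARD('a) ^ (h - g)"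
proof -
  have G: "G \<noteq> 0" "degree G = g"
    using assms by (auto simp: monic_polys_deg_iff)
  have "{C \<in> low_polys h. G dvd C} = (*) G ` low_polys (h - g)"
  proof (intro equalityI subsetI)
    fix C assume "C \<in> {C \<in> low_polys h. G dvd C}"
    moreover from this obtain Z where "C = G * Z" by auto
    ultimately show "C \<in> (*) G ` low_polys (h - g)"
      using G by (cases "Z = 0") (auto simp: low_polys_iff degree_mult_eq)
  next
    fix C assume "C \<in> (*) G ` low_polys (h - g)"
    then obtain Z where "Z \<in> low_polys (h - g)" "C = G * Z" by auto
    thus "C \<in> {C \<in> low_polys h. G dvd C}"
      using G by (cases "Z = 0") (auto simp: low_polys_iff degree_mult_eq)
  qed
  moreover have "inj_on ((*) G) (low_polys (h - g))"
    using G by (simp add: inj_on_def)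
  ultimately show ?thesis by (simp add: card_image card_low_polys)
qed

text \<open>
  Division by \<open>D\<close> writes each such \<open>X\<close> as \<open>D * Z + R mod D\<close> with \<open>Z\<close> monic of
  degree \<open>m - d\<close>. The bound \<open>d \<le> m\<close> ensures that the remainder does not
  disturb the leading term.
\<close>

lemma card_monic_in_residue_class:
  fixes D :: "'a::{field, finite} poly"
  assumes "D \<in> monic_polys_deg d" "d \<le> m"
  shows "card {X \<in> monic_polys_deg m. D dvd X - R} = CARD('a) ^ (m - d)"
proof -
  have D: "D \<noteq> 0" "degree D = d"
    using assms by (auto simp: monic_polys_deg_iff)
  have low: "R mod D \<in> low_polys m"
    using degree_mod_less[OF D(1), of R] D assms(2) by (auto simp: low_polys_iff)
  have "{X \<in> monic_polys_deg m. D dvd X - R} = (\<lambda>Z. D * Z + R mod D) ` monic_polys_deg (m - d)"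
  proof (intro equalityI subsetI)
    fix X assume X: "X \<in> {X \<in> monic_polys_deg m. D dvd X - R}"
    then obtain K where K: "X - R = D * K" by auto
    have "X - R mod D = (X - R) + (R - R mod D)" by simp
    also have "\<dots> = D * (K + R div D)"
      unfolding K by (simp add: minus_mod_eq_mult_div distrib_left)
    finally have *: "X - R mod D = D * (K + R div D)" .
    have "X - R mod D \<in> monic_polys_deg m"
      using X low by (auto intro: monic_polys_deg_diff_low)
    with * have "K + R div D \<in> monic_polys_deg (m - d)"
      using assms(1) monic_polys_deg_cofactor by metis
    moreover have "X = D * (K + R div D) + R mod D"
      unfolding *[symmetric] by simp
    ultimately show "X \<in> (\<lambda>Z. D * Z + R mod D) ` monic_polys_deg (m - d)" by blast
  next
    fix X assume "X \<in> (\<lambda>Z. D * Z + R mod D) ` monic_polys_deg (m - d)"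
    then obtain Z where Z: "Z \<in> monic_polys_deg (m - d)" "X = D * Z + R mod D" by auto
    have "D * Z \<in> monic_polys_deg m"
      using monic_polys_deg_mult[OF assms(1) Z(1)] assms(2) by simp
    hence "X \<in> monic_polys_deg m"
      using low Z(2) by (simp add: monic_polys_deg_add_low)
    moreover have "X - R = D * (Z - R div D)"
      using Z(2) by (simp add: algebra_simps minus_mult_div_eq_mod[symmetric])
    ultimately show "X \<in> {X \<in> monic_polys_deg m. D dvd X - R}" by auto
  qed
  moreover have "inj_on (\<lambda>Z. D * Z + R mod D) (monic_polys_deg (m - d))"
    using D by (simp add: inj_on_def)
  ultimately show ?thesis by (simp add: card_image card_monic_polys_deg)
qed

section \<open>Monic greatest common divisors\<close>

text \<open>
  A monic common divisor that satisfies a Bezout identity is a multiple of every common divisor, so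
  these properties determine it uniquely. Taking the Bezout identity as part of the description
  makes it directly available for solving congruences.
\<close>

definition monic_gcd :: "'a::{field, finite} poly \<Rightarrow> 'a poly \<Rightarrow> 'a poly" where
  "monic_gcd A B =
     (THE G. G \<in> monic_polys \<and> G dvd A \<and> G dvd B \<and> (\<exists>U V. G = U * A + V * B))"

lemma monic_dvd_antisym:
  assumes "G \<in> monic_polys" "H \<in> monic_polys" "G dvd H" "H dvd G"
  shows "G = H"
proof -
  have 0: "G \<noteq> 0" "H \<noteq> 0" using assms by (auto simp: monic_polys_def)
  obtain K where K: "H = G * K" using assms(3) by auto
  have "degree H \<le> degree G" using assms(4) 0 by (simp add: dvd_imp_degree_le)
  hence "degree K = 0" using K 0 by (auto simp: degree_mult_eq)
  then obtain c where c: "K = [:c:]" by (rule degree_eq_zeroE)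
  hence "lead_coeff H = lead_coeff G * c" using K by simp
  hence "c = 1" using assms(1,2) by (simp add: monic_polys_def)
  thus ?thesis using K c by simp
qed

text \<open>
  A nonzero element of least degree in the ideal generated by \<open>A\<close> and \<open>B\<close> divides
  every element of the ideal, since the remainder of a division by it is again in the ideal.
\<close>

lemma monic_gcd_exists:
  fixes A B :: "'a::{field, finite} poly"
  assumes "A \<noteq> 0"
  shows "\<exists>G. G \<in> monic_polys \<and> G dvd A \<and> G dvd B \<and> (\<exists>U V. G = U * A + V * B)"
proof -
  define I where "I = {U * A + V * B |U V. True}"
  have "A = 1 * A + 0 * B" by simp
  hence "A \<in> I" unfolding I_def by blast
  have "\<exists>P. (P \<in> I \<and> P \<noteq> 0) \<and> (\<forall>Q. Q \<in> I \<and> Q \<noteq> 0 \<longrightarrow> degree P \<le> degree Q)"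
    using \<open>A \<in> I\<close> assms by (intro ex_has_least_nat[of _ A]) auto
  then obtain P where P: "P \<in> I" "P \<noteq> 0" "\<And>Q. Q \<in> I \<Longrightarrow> Q \<noteq> 0 \<Longrightarrow> degree P \<le> degree Q"
    by blast
  have dvd: "P dvd Q" if Q: "Q \<in> I" for Q
  proof -
    obtain U V where UV: "P = U * A + V * B" using P(1) unfolding I_def by auto
    obtain U' V' where UV': "Q = U' * A + V' * B" using Q unfolding I_def by auto
    have "Q mod P = Q - (Q div P) * P" by (simp add: minus_div_mult_eq_mod)
    also have "\<dots> = (U' - (Q div P) * U) * A + (V' - (Q div P) * V) * B"
    proof -
      have "(Q div P) * P = (Q div P) * U * A + (Q div P) * V * B"
        by (subst (2) UV) (simp add: algebra_simps)
      thus ?thesis using UV' by (simp add: algebra_simps)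
    qed
    finally have "Q mod P \<in> I" unfolding I_def by blast
    moreover have "Q mod P = 0 \<or> degree (Q mod P) < degree P"
      using degree_mod_less[OF P(2)] .
    ultimately have "Q mod P = 0" using P(3) by fastforce
    thus ?thesis by (simp add: mod_eq_0_iff_dvd)
  qed
  \<comment> \<open>Normalizing the leading coefficient leaves both divisibility and the Bezout identity intact.\<close>
  define G where "G = smult (inverse (lead_coeff P)) P"
  have "B = 0 * A + 1 * B" by simp
  hence "B \<in> I" unfolding I_def by blast
  have "G \<in> monic_polys" using P(2) by (simp add: G_def monic_polys_def)
  moreover have "G dvd A" "G dvd B"
    using P(2) dvd \<open>A \<in> I\<close> \<open>B \<in> I\<close> by (simp_all add: G_def smult_dvd)
  moreover have "\<exists>U V. G = U * A + V * B"
  proof -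
    obtain U V where UV: "P = U * A + V * B" using P(1) unfolding I_def by auto
    have "G = smult (inverse (lead_coeff P)) U * A + smult (inverse (lead_coeff P)) V * B"
      unfolding G_def by (subst (2) UV) (simp add: smult_add_right)
    thus ?thesis by blast
  qed
  ultimately show ?thesis by blast
qed

lemma monic_gcd_eqI:
  assumes "G \<in> monic_polys" "G dvd A" "G dvd B" "G = U * A + V * B"
  shows "monic_gcd A B = G"
  unfolding monic_gcd_def
proof (rule the_equality)
  show "G \<in> monic_polys \<and> G dvd A \<and> G dvd B \<and> (\<exists>U V. G = U * A + V * B)"
    using assms by blast
next
  fix H assume H: "H \<in> monic_polys \<and> H dvd A \<and> H dvd B \<and> (\<exists>U V. H = U * A + V * B)"
  then obtain U' V' where "H = U' * A + V' * B" by blast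
  hence "G dvd H" using assms(2,3) by simp
  moreover have "H dvd G" unfolding assms(4) using H by simp
  ultimately show "H = G" using H assms(1) monic_dvd_antisym by blast
qed

lemma monic_gcd_props:
  assumes "A \<noteq> 0"
  shows "monic_gcd A B \<in> monic_polys" "monic_gcd A B dvd A" "monic_gcd A B dvd B"
    "\<exists>U V. monic_gcd A B = U * A + V * B"
  using monic_gcd_exists[OF assms, of B] monic_gcd_eqI by metis+

lemma monic_gcd_decompose:
  assumes "A \<in> monic_polys_deg a" "B \<in> monic_polys_deg b"
  defines "G \<equiv> monic_gcd A B" and "g \<equiv> degree (monic_gcd A B)"
  obtains A' B' U V where "G \<in> monic_polys_deg g" "g \<le> a" "g \<le> b"
    "A = G * A'" "B = G * B'" "A' \<in> monic_polys_deg (a - g)" "B' \<in> monic_polys_deg (b - g)"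
    "U * A' + V * B' = 1"
proof -
  have A0: "A \<noteq> 0" using assms(1) by (rule monic_polys_deg_nonzero)
  have G: "G \<in> monic_polys_deg g"
    using monic_gcd_props(1)[OF A0] by (simp add: G_def g_def monic_polys_deg_def)
  obtain A' B' where AB: "A = G * A'" "B = G * B'"
    using monic_gcd_props(2,3)[OF A0] unfolding G_def by (metis dvdE)
  obtain U V where "G = U * A + V * B"
    using monic_gcd_props(4)[OF A0] unfolding G_def by blast
  also have "\<dots> = G * (U * A' + V * B')"
    using AB by (simp add: algebra_simps)
  finally have "G = G * (U * A' + V * B')" .
  hence "U * A' + V * B' = 1"
    using monic_polys_deg_nonzero[OF G] by simp
  moreover have "g \<le> a" "g \<le> b" "A' \<in> monic_polys_deg (a - g)" "B' \<in> monic_polys_deg (b - g)"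
    using monic_polys_deg_cofactor G assms(1,2) AB by metis+
  ultimately show thesis using that G AB by blast
qed

section \<open>Near-equal multiples of two fixed polynomials\<close>

text \<open>
  The Bezout identity makes \<open>U\<close> an inverse of \<open>A\<close> modulo \<open>B\<close>.
\<close>

lemma dvd_linear_congruence:
  fixes A B C :: "'a::{field, finite} poly"
  assumes "U * A + V * B = 1"
  shows "B dvd A * X - C \<longleftrightarrow> B dvd X - U * C"
proof
  assume "B dvd A * X - C"
  hence "B dvd U * (A * X - C) + B * (V * X)" by simp
  moreover have "U * (A * X - C) + B * (V * X) = (U * A + V * B) * X - U * C"
    by (simp add: algebra_simps)
  ultimately show "B dvd X - U * C" using assms by simp
next
  assume "B dvd X - U * C"
  hence "B dvd A * (X - U * C) - B * (V * C)" by simp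
  moreover have "A * (X - U * C) - B * (V * C) = A * X - (U * A + V * B) * C"
    by (simp add: algebra_simps)
  ultimately show "B dvd A * X - C" using assms by simp
qed

text \<open>
  With \<open>C = A * X - B * Y\<close>, the pair \<open>(X, Y)\<close> is determined by \<open>(C, X)\<close>. Let \<open>g\<close> be the
  degree of the gcd of \<open>A\<close> and \<open>B\<close>. The polynomial \<open>C\<close> ranges over
  the multiples of this gcd of degree below \<open>h\<close>, which gives \<open>q ^ (h - g)\<close> choices, where
  the exponent is \<open>0\<close> if \<open>h \<le> g\<close>. For given \<open>C\<close>, the monic polynomial \<open>X\<close>
  of degree \<open>n - a\<close> ranges over one residue class to a modulus of degree \<open>b - g\<close>.
  The hypothesis \<open>a + b \<le> n\<close> guarantees that this modulus has degree at most that of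
  \<open>X\<close>, so that each residue class is hit equally often. Then \<open>Y\<close> is automatically
  monic of degree \<open>n - b\<close>, because \<open>h \<le> n\<close>.
\<close>

lemma card_near_equal_multiples:
  fixes A B :: "'a::{field, finite} poly"
  assumes A: "A \<in> monic_polys_deg a" and B: "B \<in> monic_polys_deg b"
    and n: "a + b \<le> n" and h: "h \<le> n"
  shows "card {(X, Y). X \<in> monic_polys_deg (n - a) \<and> Y \<in> monic_polys_deg (n - b) \<and>
            A * X - B * Y \<in> low_polys h}
         = CARD('a) ^ (n - a - b + max h (degree (monic_gcd A B)))" (is "card ?S = _")
proof -
  define G g where "G = monic_gcd A B" and "g = degree (monic_gcd A B)"
  obtain A' B' U V where G: "G \<in> monic_polys_deg g" "g \<le> a" "g \<le> b"
    "A = G * A'" "B = G * B'" "A' \<in> monic_polys_deg (a - g)" "B' \<in> monic_polys_deg (b - g)"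
    "U * A' + V * B' = 1"
    using monic_gcd_decompose[OF A B] unfolding G_def g_def by metis
  have G0: "G \<noteq> 0" and B0: "B \<noteq> 0" using G B monic_polys_deg_nonzero by auto
  define L where "L = {C \<in> low_polys h. G dvd C}"
  define R where "R C = {X \<in> monic_polys_deg (n - a). B dvd A * X - C}" for C
  have card_R: "card (R C) = CARD('a) ^ (n - a - (b - g))" if C: "C \<in> L" for C
  proof -
    obtain C' where C': "C = G * C'" using C unfolding L_def by auto
    have "B dvd A * X - C \<longleftrightarrow> B' dvd X - U * C'" for X
    proof -
      have "A * X - C = G * (A' * X - C')" by (simp add: G(4) C' algebra_simps)
      hence "B dvd A * X - C \<longleftrightarrow> B' dvd A' * X - C'" using G0 by (simp add: G(5))
      thus ?thesis using dvd_linear_congruence[OF G(8)] by simp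
    qed
    hence "R C = {X \<in> monic_polys_deg (n - a). B' dvd X - U * C'}" by (simp add: R_def)
    thus ?thesis using card_monic_in_residue_class[OF G(7)] n by simp
  qed
  have "bij_betw (\<lambda>(C, X). (X, (A * X - C) div B)) (SIGMA C:L. R C) ?S"
  proof (rule bij_betw_byWitness[where f' = "\<lambda>(X, Y). (A * X - B * Y, X)"])
    show "\<forall>p\<in>SIGMA C:L. R C. (\<lambda>(X, Y). (A * X - B * Y, X)) ((\<lambda>(C, X). (X, (A * X - C) div B)) p) = p"
      by (auto simp: R_def)
    show "\<forall>p\<in>?S. (\<lambda>(C, X). (X, (A * X - C) div B)) ((\<lambda>(X, Y). (A * X - B * Y, X)) p) = p"
      using B0 by auto
    show "(\<lambda>(C, X). (X, (A * X - C) div B)) ` (SIGMA C:L. R C) \<subseteq> ?S"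
    proof clarsimp
      fix C X assume "C \<in> L" "X \<in> R C"
      hence C: "C \<in> low_polys h" and X: "X \<in> monic_polys_deg (n - a)"
        and dvd: "B dvd A * X - C"
        by (auto simp: L_def R_def)
      have "A * X \<in> monic_polys_deg n" using monic_polys_deg_mult[OF A X] n by simp
      hence "A * X - C \<in> monic_polys_deg n"
        using C low_polys_mono[OF h] by (auto intro: monic_polys_deg_diff_low)
      moreover have "B * ((A * X - C) div B) = A * X - C" using dvd by simp
      ultimately have "(A * X - C) div B \<in> monic_polys_deg (n - b)"
        using monic_polys_deg_cofactor(2)[OF _ B] by simp
      thus "X \<in> monic_polys_deg (n - a) \<and> (A * X - C) div B \<in> monic_polys_deg (n - b) \<and>
            A * X - B * ((A * X - C) div B) \<in> low_polys h"
        using X C dvd by simp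
    qed
    show "(\<lambda>(X, Y). (A * X - B * Y, X)) ` ?S \<subseteq> (SIGMA C:L. R C)"
      using G(4,5) by (auto simp: L_def R_def)
  qed
  hence "card ?S = card (SIGMA C:L. R C)" by (simp add: bij_betw_same_card)
  also have "\<dots> = (\<Sum>C\<in>L. card (R C))"
    by (rule card_SigmaI) (auto simp: L_def R_def)
  also have "\<dots> = CARD('a) ^ (h - g) * CARD('a) ^ (n - a - (b - g))"
    using card_low_multiples[OF G(1), of h] card_R by (simp add: L_def)
  also have "\<dots> = CARD('a) ^ ((h - g) + (n - a - (b - g)))" by (simp add: power_add)
  also have "(h - g) + (n - a - (b - g)) = n - a - b + max h g"
    using n G(2,3) by (auto simp: max_def)
  finally show ?thesis unfolding g_def .
qed

section \<open>The distribution of the degree of the gcd\<close>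

definition coprime_pairs :: "nat \<Rightarrow> nat \<Rightarrow> ('a::{field, finite} poly \<times> 'a poly) set" where
  "coprime_pairs i j =
     {(A, B). A \<in> monic_polys_deg i \<and> B \<in> monic_polys_deg j \<and> monic_gcd A B = 1}"

text \<open>
  Splitting off the gcd identifies a pair with its gcd and a coprime pair of smaller degrees.
\<close>

lemma card_pairs_gcd_degree_eq:
  fixes i j k :: nat
  assumes "k \<le> i" "k \<le> j"
  shows "card {(A :: 'a::{field, finite} poly, B). A \<in> monic_polys_deg i \<and> B \<in> monic_polys_deg j \<and>
                 degree (monic_gcd A B) = k}
       = CARD('a) ^ k *
           card (coprime_pairs (i - k) (j - k) :: ('a poly \<times> 'a poly) set)"
    (is "card ?S = _")
proof -
  have gcd_mult: "monic_gcd (D * A) (D * B) = D"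
    if D: "D \<in> monic_polys_deg k" and AB: "(A, B) \<in> coprime_pairs (i - k) (j - k)"
    for D A B :: "'a poly"
  proof -
    have "A \<noteq> 0" using AB by (auto simp: coprime_pairs_def dest: monic_polys_deg_nonzero)
    then obtain U V where "1 = U * A + V * B"
      using monic_gcd_props(4)[of A B] AB by (auto simp: coprime_pairs_def)
    hence "D = D * (U * A + V * B)" by simp
    hence "D = U * (D * A) + V * (D * B)" by (simp add: algebra_simps)
    thus ?thesis using D by (intro monic_gcd_eqI) (auto simp: monic_polys_deg_def)
  qed
  have "bij_betw (\<lambda>(D, A, B). (D * A, D * B))
          (monic_polys_deg k \<times> coprime_pairs (i - k) (j - k)) ?S"
    unfolding bij_betw_def
  proof (intro conjI)
    show "inj_on (\<lambda>(D, A, B). (D * A, D * B))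
            (monic_polys_deg k \<times> (coprime_pairs (i - k) (j - k) :: ('a poly \<times> 'a poly) set))"
    proof (rule inj_onI)
      fix p p' :: "'a poly \<times> 'a poly \<times> 'a poly"
      assume "p \<in> monic_polys_deg k \<times> coprime_pairs (i - k) (j - k)"
        "p' \<in> monic_polys_deg k \<times> coprime_pairs (i - k) (j - k)"
        and eq: "(\<lambda>(D, A, B). (D * A, D * B)) p = (\<lambda>(D, A, B). (D * A, D * B)) p'"
      then obtain D A B D' A' B' where p: "p = (D, A, B)" "p' = (D', A', B')"
        and *: "D \<in> monic_polys_deg k" "(A, B) \<in> coprime_pairs (i - k) (j - k)"
          "D' \<in> monic_polys_deg k" "(A', B') \<in> coprime_pairs (i - k) (j - k)"
        by auto
      have "D = D'" using gcd_mult[OF *(1,2)] gcd_mult[OF *(3,4)] eq by (simp add: p)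
      thus "p = p'"
        using eq monic_polys_deg_nonzero[OF *(1)] by (simp add: p)
    qed
    show "(\<lambda>(D, A, B). (D * A, D * B)) ` (monic_polys_deg k \<times> coprime_pairs (i - k) (j - k)) = ?S"
    proof (intro equalityI subsetI)
      fix p :: "'a poly \<times> 'a poly"
      assume "p \<in> (\<lambda>(D, A, B). (D * A, D * B)) ` (monic_polys_deg k \<times> coprime_pairs (i - k) (j - k))"
      then obtain D A B where p: "p = (D * A, D * B)" and D: "D \<in> monic_polys_deg k"
        and AB: "(A, B) \<in> coprime_pairs (i - k) (j - k)" by auto
      have "D * A \<in> monic_polys_deg i" "D * B \<in> monic_polys_deg j"
        using monic_polys_deg_mult[OF D, of A "i - k"] monic_polys_deg_mult[OF D, of B "j - k"] AB assms
        by (auto simp: coprime_pairs_def)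
      thus "p \<in> ?S" using gcd_mult[OF D AB] D by (simp add: p monic_polys_deg_def)
    next
      fix p :: "'a poly \<times> 'a poly" assume "p \<in> ?S"
      then obtain A B where p: "p = (A, B)" and A: "A \<in> monic_polys_deg i"
        and B: "B \<in> monic_polys_deg j" and k: "degree (monic_gcd A B) = k" by auto
      obtain A' B' U V where G: "monic_gcd A B \<in> monic_polys_deg k"
        "A = monic_gcd A B * A'" "B = monic_gcd A B * B'"
        "A' \<in> monic_polys_deg (i - k)" "B' \<in> monic_polys_deg (j - k)" "U * A' + V * B' = 1"
        using monic_gcd_decompose[OF A B] unfolding k by metis
      have "monic_gcd A' B' = 1"
        by (rule monic_gcd_eqI[where U = U and V = V]) (use G(6) in \<open>auto simp: monic_polys_def\<close>)
      hence "(A', B') \<in> coprime_pairs (i - k) (j - k)" using G by (simp add: coprime_pairs_def)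
      thus "p \<in> (\<lambda>(D, A, B). (D * A, D * B)) ` (monic_polys_deg k \<times> coprime_pairs (i - k) (j - k))"
        using G(1,2,3) p by (intro image_eqI[of _ _ "(monic_gcd A B, A', B')"]) auto
    qed
  qed
  hence "card ?S = card ((monic_polys_deg k :: 'a poly set) \<times> (coprime_pairs (i - k) (j - k) :: ('a poly \<times> 'a poly) set))"
    by (rule bij_betw_same_card[THEN sym])
  thus ?thesis by (simp add: card_cartesian_product card_monic_polys_deg)
qed

lemma card_pairs_gcd_degree_ge_sum:
  assumes "k \<le> i" "k \<le> j"
  shows "card {(A :: 'a::{field, finite} poly, B). A \<in> monic_polys_deg i \<and> B \<in> monic_polys_deg j \<and>
                 k \<le> degree (monic_gcd A B)}
       = (\<Sum>l = k..min i j. CARD('a) ^ l *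
           card (coprime_pairs (i - l) (j - l) :: ('a poly \<times> 'a poly) set))"
    (is "card ?S = _")
proof -
  let ?E = "\<lambda>l. {(A :: 'a poly, B). A \<in> monic_polys_deg i \<and> B \<in> monic_polys_deg j \<and>
                 degree (monic_gcd A B) = l}"
  have fin: "finite (?E l)" for l
    by (rule finite_subset[of _ "monic_polys_deg i \<times> monic_polys_deg j"]) auto
  have "degree (monic_gcd A B) \<le> min i j"
    if "A \<in> monic_polys_deg i" "B \<in> monic_polys_deg j" for A B :: "'a poly"
    by (rule monic_gcd_decompose[OF that]) simp
  hence "?S = (\<Union>l\<in>{k..min i j}. ?E l)" by fastforce
  also have "card \<dots> = (\<Sum>l = k..min i j. card (?E l))"
    using fin by (intro card_UN_disjoint) auto
  also have "\<dots> = (\<Sum>l = k..min i j. CARD('a) ^ l *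
           card (coprime_pairs (i - l) (j - l) :: ('a poly \<times> 'a poly) set))"
    using card_pairs_gcd_degree_eq by (intro sum.cong) auto
  finally show ?thesis .
qed

text \<open>
  The number of coprime pairs drops out of the computation by self-similarity. Summing
  the decomposition over all gcd degrees \<open>l \<ge> k\<close> and shifting \<open>l\<close> by \<open>k\<close> gives
  \<open>q ^ k\<close> times the same sum over all gcd degrees for the degrees \<open>i - k\<close> and
  \<open>j - k\<close>; and that last sum counts all pairs of these degrees.
\<close>

lemma card_pairs_gcd_degree_ge:
  assumes "k \<le> i" "k \<le> j"
  shows "card {(A :: 'a::{field, finite} poly, B). A \<in> monic_polys_deg i \<and> B \<in> monic_polys_deg j \<and>
                 k \<le> degree (monic_gcd A B)} = CARD('a) ^ (i + j - k)"
    (is "card ?S = _")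
proof -
  let ?c = "\<lambda>i j. card (coprime_pairs i j :: ('a poly \<times> 'a poly) set)"
  have "card ?S = (\<Sum>l = k..min i j. CARD('a) ^ l * ?c (i - l) (j - l))"
    by (rule card_pairs_gcd_degree_ge_sum[OF assms])
  also have "\<dots> = (\<Sum>l = 0..min (i - k) (j - k). CARD('a) ^ (l + k) * ?c (i - (l + k)) (j - (l + k)))"
    using assms by (intro sum.reindex_bij_witness[of _ "\<lambda>l. l + k" "\<lambda>l. l - k"]) auto
  also have "\<dots> = CARD('a) ^ k *
      (\<Sum>l = 0..min (i - k) (j - k). CARD('a) ^ l * ?c (i - k - l) (j - k - l))"
    by (simp add: sum_distrib_left power_add algebra_simps)
  also have "(\<Sum>l = 0..min (i - k) (j - k). CARD('a) ^ l * ?c (i - k - l) (j - k - l)) =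
      card (monic_polys_deg (i - k) \<times> monic_polys_deg (j - k) :: ('a poly \<times> 'a poly) set)"
  proof -
    have "{(A :: 'a poly, B). A \<in> monic_polys_deg (i - k) \<and> B \<in> monic_polys_deg (j - k)} =
        monic_polys_deg (i - k) \<times> monic_polys_deg (j - k)" by auto
    thus ?thesis
      using card_pairs_gcd_degree_ge_sum[of 0 "i - k" "j - k", where 'a = 'a] by simp
  qed
  also have "\<dots> = CARD('a) ^ (i - k + (j - k))"
    by (simp add: card_cartesian_product card_monic_polys_deg power_add)
  finally show ?thesis using assms by (simp add: power_add[symmetric])
qed

text \<open>
  Summation by parts in the form used twice below: for the weight \<open>q ^ max h g\<close> and, with
  \<open>f = real\<close>, for a layer-cake formula.
\<close>

lemma max_telescope:
  fixes f :: "nat \<Rightarrow> real"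
  assumes "g \<le> N"
  shows "f (max h g) = f h + (\<Sum>k\<in>{h<..N}. of_bool (k \<le> g) * (f k - f (k - 1)))"
proof -
  have "(\<Sum>k\<in>{h<..N}. of_bool (k \<le> g) * (f k - f (k - 1))) =
      (\<Sum>k\<in>{Suc h..max h g}. f k - f (k - 1))"
    using assms by (intro sum.mono_neutral_cong_right) auto
  also have "\<dots> = f (max h g) - f h" by (rule sum_telescope'') simp
  finally show ?thesis by simp
qed

text \<open>
  Summation by parts reduces the weighted sum to the tail counts \<open>q ^ (a + b - k)\<close>. Against them,
  each increment \<open>q ^ k - q ^ (k - 1)\<close> contributes the same amount
  \<open>q ^ (a + b) * (1 - 1 / q)\<close>, which is why the answer is linear in \<open>min a b - h\<close>.
\<close>

lemma sum_power_max_gcd_degree: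
  fixes a b h :: nat
  defines "q \<equiv> real CARD('a::{field, finite})"
  shows "(\<Sum>(A :: 'a poly, B)\<in>monic_polys_deg a \<times> monic_polys_deg b.
            q ^ max h (degree (monic_gcd A B))) =
         q ^ (a + b) * (q ^ h + (1 - 1 / q) * real (min a b - h))"
proof -
  let ?M = "monic_polys_deg a \<times> monic_polys_deg b :: ('a poly \<times> 'a poly) set"
  let ?g = "\<lambda>(A :: 'a poly, B). degree (monic_gcd A B)"
  have q: "q > 0" by (simp add: q_def)
  have g_le: "?g p \<le> min a b" if p_in: "p \<in> ?M" for p
  proof -
    obtain A B where p: "p = (A, B)" "A \<in> monic_polys_deg a" "B \<in> monic_polys_deg b"
      using p_in by auto
    show ?thesis by (rule monic_gcd_decompose[OF p(2,3)]) (simp add: p(1))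
  qed
  have tail: "(\<Sum>p\<in>?M. of_bool (k \<le> ?g p)) = q ^ (a + b - k)" if "k \<le> min a b" for k
  proof -
    have "(\<Sum>p\<in>?M. of_bool (k \<le> ?g p)) = real (card {p \<in> ?M. k \<le> ?g p})"
      by (simp add: sum_of_bool_eq Int_def)
    also have "{p \<in> ?M. k \<le> ?g p} = {(A, B). A \<in> monic_polys_deg a \<and> B \<in> monic_polys_deg b \<and>
                 k \<le> degree (monic_gcd A B)}" by auto
    also have "real (card \<dots>) = q ^ (a + b - k)"
      using that by (simp add: card_pairs_gcd_degree_ge q_def)
    finally show ?thesis .
  qed
  have "(\<Sum>p\<in>?M. q ^ max h (?g p)) =
      (\<Sum>p\<in>?M. q ^ h + (\<Sum>k\<in>{h<..min a b}. of_bool (k \<le> ?g p) * (q ^ k - q ^ (k - 1))))"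
    using max_telescope[OF g_le, of _ "\<lambda>k. q ^ k" h] by (intro sum.cong refl) blast
  also have "\<dots> = real (card ?M) * q ^ h +
      (\<Sum>k\<in>{h<..min a b}. (\<Sum>p\<in>?M. of_bool (k \<le> ?g p)) * (q ^ k - q ^ (k - 1)))"
  proof -
    have "(\<Sum>p\<in>?M. \<Sum>k\<in>{h<..min a b}. of_bool (k \<le> ?g p) * (q ^ k - q ^ (k - 1))) =
        (\<Sum>k\<in>{h<..min a b}. (\<Sum>p\<in>?M. of_bool (k \<le> ?g p)) * (q ^ k - q ^ (k - 1)))"
      by (subst sum.swap) (simp only: sum_distrib_right)
    thus ?thesis by (simp only: sum.distrib sum_constant)
  qed
  also have "\<dots> = q ^ (a + b) * q ^ h +
      (\<Sum>k\<in>{h<..min a b}. q ^ (a + b - k) * (q ^ k - q ^ (k - 1)))"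
    using tail by (simp add: card_cartesian_product card_monic_polys_deg power_add q_def
        del: sum_of_bool_eq)
  also have "(\<Sum>k\<in>{h<..min a b}. q ^ (a + b - k) * (q ^ k - q ^ (k - 1))) =
      (\<Sum>k\<in>{h<..min a b}. q ^ (a + b) * (1 - 1 / q))"
  proof (rule sum.cong[OF refl])
    fix k assume k: "k \<in> {h<..min a b}"
    have "q ^ k - q ^ (k - 1) = q ^ k * (1 - 1 / q)"
      using k q by (cases k) (auto simp: field_simps)
    moreover have "q ^ (a + b - k) * q ^ k = q ^ (a + b)"
      using k by (simp add: power_add[symmetric])
    ultimately show "q ^ (a + b - k) * (q ^ k - q ^ (k - 1)) = q ^ (a + b) * (1 - 1 / q)"
      by (simp add: mult.assoc[symmetric])
  qed
  finally show ?thesis by (simp add: case_prod_unfold algebra_simps)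
qed

section \<open>Moments of the number of near factorizations\<close>

definition near_factorizations ::
  "nat \<Rightarrow> nat \<Rightarrow> nat \<Rightarrow> 'a::{field, finite} poly \<Rightarrow> ('a poly \<times> 'a poly) set" where
  "near_factorizations n h a A =
     {(X, Y). X \<in> monic_polys_deg a \<and> Y \<in> monic_polys_deg (n - a) \<and> X * Y - A \<in> low_polys h}"

definition near_product_pairs ::
  "nat \<Rightarrow> nat \<Rightarrow> nat \<Rightarrow> nat \<Rightarrow>
     (('a::{field, finite} poly \<times> 'a poly) \<times> ('a poly \<times> 'a poly)) set" where
  "near_product_pairs n h a b =
     {((X, Y), (X', Y')). X \<in> monic_polys_deg a \<and> Y \<in> monic_polys_deg (n - a) \<and>
        X' \<in> monic_polys_deg b \<and> Y' \<in> monic_polys_deg (n - b) \<and> X * Y - X' * Y' \<in> low_polys h}"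

lemma finite_near_factorizations [simp]: "finite (near_factorizations n h a A)"
  by (rule finite_subset[of _ "monic_polys_deg a \<times> monic_polys_deg (n - a)"])
    (auto simp: near_factorizations_def)

lemma finite_near_product_pairs [simp]: "finite (near_product_pairs n h a b)"
  by (rule finite_subset[of _ "(monic_polys_deg a \<times> monic_polys_deg (n - a)) \<times>
        (monic_polys_deg b \<times> monic_polys_deg (n - b))"])
    (auto simp: near_product_pairs_def)

lemma sum_card_near_factorizations:
  assumes "a \<le> n" "h \<le> n"
  shows "(\<Sum>A\<in>(monic_polys_deg n :: 'a::{field, finite} poly set).
            card (near_factorizations n h a A)) = CARD('a) ^ (n + h)"
proof -
  let ?R = "\<lambda>A (X :: 'a poly, Y). X * Y - A \<in> low_polys h"
  let ?t = "monic_polys_deg a \<times> monic_polys_deg (n - a) :: ('a poly \<times> 'a poly) set"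
  have "(\<Sum>A\<in>monic_polys_deg n. card {p \<in> ?t. ?R A p}) = (\<Sum>p\<in>?t. CARD('a) ^ h)"
  proof (rule sum_multicount_gen)
    show "\<forall>p\<in>?t. card {A \<in> monic_polys_deg n. ?R A p} = CARD('a) ^ h"
      using monic_polys_deg_mult[of _ a _ "n - a"] assms
      by (auto intro!: card_low_neighbours)
  qed auto
  moreover have "{p \<in> ?t. ?R A p} = near_factorizations n h a A" for A
    by (auto simp: near_factorizations_def)
  ultimately show ?thesis
    using assms by (simp add: card_cartesian_product card_monic_polys_deg power_add[symmetric])
qed

text \<open>
  Double counting: two products that lie within distance \<open>h\<close> of a common \<open>A\<close> lie
  within distance \<open>h\<close> of each other, and conversely the admissible \<open>A\<close> are then
  the \<open>q ^ h\<close> neighbours of the first product.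
\<close>

lemma sum_card_near_factorizations_product:
  assumes "a \<le> n" "b \<le> n" "h \<le> n"
  shows "(\<Sum>A\<in>(monic_polys_deg n :: 'a poly set).
            card (near_factorizations n h a A) * card (near_factorizations n h b A)) =
         CARD('a) ^ h *
           card (near_product_pairs n h a b ::
                   (('a::{field, finite} poly \<times> 'a poly) \<times> ('a poly \<times> 'a poly)) set)"
proof -
  let ?R = "\<lambda>A ((X :: 'a poly, Y), (X', Y')). X * Y - A \<in> low_polys h \<and> X' * Y' - A \<in> low_polys h"
  let ?t = "near_product_pairs n h a b :: (('a poly \<times> 'a poly) \<times> ('a poly \<times> 'a poly)) set"
  have "(\<Sum>A\<in>monic_polys_deg n. card {p \<in> ?t. ?R A p}) = (\<Sum>p\<in>?t. CARD('a) ^ h)"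
  proof (rule sum_multicount_gen)
    show "\<forall>p\<in>?t. card {A \<in> monic_polys_deg n. ?R A p} = CARD('a) ^ h"
    proof
      fix p assume "p \<in> ?t"
      then obtain X Y X' Y' where p: "p = ((X, Y), (X', Y'))"
        and XY: "X \<in> monic_polys_deg a" "Y \<in> monic_polys_deg (n - a)"
        and near: "X * Y - X' * Y' \<in> low_polys h"
        by (auto simp: near_product_pairs_def)
      have "X' * Y' - A \<in> low_polys h" if "X * Y - A \<in> low_polys h" for A
        using low_polys_diff[OF that near] by simp
      hence "{A \<in> monic_polys_deg n. ?R A p} = {A \<in> monic_polys_deg n. X * Y - A \<in> low_polys h}"
        by (auto simp: p)
      thus "card {A \<in> monic_polys_deg n. ?R A p} = CARD('a) ^ h"
        using monic_polys_deg_mult[OF XY] assms by (simp add: card_low_neighbours)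
    qed
  qed auto
  moreover have "{p \<in> ?t. ?R A p} = near_factorizations n h a A \<times> near_factorizations n h b A" for A
  proof -
    have "P - Q \<in> low_polys h" if "P - A \<in> low_polys h" "Q - A \<in> low_polys h" for P Q :: "'a poly"
      using low_polys_diff[OF that] by simp
    thus ?thesis by (auto simp: near_factorizations_def near_product_pairs_def)
  qed
  ultimately show ?thesis by (simp add: card_cartesian_product mult.commute)
qed

text \<open>
  Interchanging the factors of both products reduces the case \<open>a + b > n\<close> to the case
  \<open>a + b \<le> n\<close>.
\<close>

lemma card_near_product_pairs_flip:
  assumes "a \<le> n" "b \<le> n"
  shows "card (near_product_pairs n h a b :: (('a::{field, finite} poly \<times> 'a poly) \<times> _) set) =
         card (near_product_pairs n h (n - a) (n - b) :: (('a poly \<times> 'a poly) \<times> _) set)"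
  by (rule bij_betw_same_card[of "map_prod prod.swap prod.swap"],
      rule bij_betw_byWitness[where f' = "map_prod prod.swap prod.swap"])
    (use assms in \<open>auto simp: near_product_pairs_def mult.commute\<close>)

text \<open>
  Regrouping: for given first factors \<open>X\<close> and \<open>X'\<close> the second factors are
  counted through the degree of the gcd of \<open>X\<close> and \<open>X'\<close>.
\<close>

lemma card_near_product_pairs_low:
  fixes a b h n :: nat
  defines "q \<equiv> real CARD('a::{field, finite})"
  assumes "a + b \<le> n" "h \<le> n"
  shows "real (card (near_product_pairs n h a b :: (('a poly \<times> 'a poly) \<times> _) set)) =
         q ^ n * (q ^ h + (1 - 1 / q) * real (min a b - h))"
proof -
  let ?F = "\<lambda>(X, X'). {(Y :: 'a poly, Y'). Y \<in> monic_polys_deg (n - a) \<and> Y' \<in> monic_polys_deg (n - b) \<and>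
      X * Y - X' * Y' \<in> low_polys h}"
  let ?M = "monic_polys_deg a \<times> monic_polys_deg b :: ('a poly \<times> 'a poly) set"
  have fin: "finite (?F p)" for p
    by (rule finite_subset[of _ "monic_polys_deg (n - a) \<times> monic_polys_deg (n - b)"]) auto
  have "bij_betw (\<lambda>((X, X'), (Y, Y')). ((X, Y), (X', Y'))) (SIGMA p:?M. ?F p)
          (near_product_pairs n h a b)"
    by (rule bij_betw_byWitness[where f' = "\<lambda>((X, X'), (Y, Y')). ((X, Y), (X', Y'))"])
      (auto simp: near_product_pairs_def)
  hence "card (near_product_pairs n h a b :: (('a poly \<times> 'a poly) \<times> _) set) = card (SIGMA p:?M. ?F p)"
    by (simp add: bij_betw_same_card)
  also have "\<dots> = (\<Sum>p\<in>?M. card (?F p))"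
    using fin by (intro card_SigmaI) auto
  also have "\<dots> = (\<Sum>(X, X')\<in>?M. CARD('a) ^ (n - a - b + max h (degree (monic_gcd X X'))))"
    using assms by (intro sum.cong) (auto simp: card_near_equal_multiples)
  finally have "real (card (near_product_pairs n h a b :: (('a poly \<times> 'a poly) \<times> _) set)) =
      q ^ (n - a - b) * (\<Sum>(X, X')\<in>?M. q ^ max h (degree (monic_gcd X X')))"
    by (simp add: q_def case_prod_unfold power_add sum_distrib_left)
  also have "\<dots> = q ^ (n - a - b) * q ^ (a + b) * (q ^ h + (1 - 1 / q) * real (min a b - h))"
    unfolding q_def sum_power_max_gcd_degree by (simp only: mult.assoc)
  also have "q ^ (n - a - b) * q ^ (a + b) = q ^ n"
    using assms by (simp add: power_add[symmetric])
  finally show ?thesis .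
qed

lemma card_near_product_pairs:
  fixes a b h n :: nat
  defines "q \<equiv> real CARD('a::{field, finite})"
  assumes "a \<le> n" "b \<le> n" "h \<le> n"
  shows "real (card (near_product_pairs n h a b :: (('a poly \<times> 'a poly) \<times> _) set)) =
         q ^ n * (q ^ h + (1 - 1 / q) * real (min (min a (n - a)) (min b (n - b)) - h))"
proof (cases "a + b \<le> n")
  case True
  hence "min (min a (n - a)) (min b (n - b)) = min a b" by auto
  thus ?thesis using True assms card_near_product_pairs_low by simp
next
  case False
  hence "min (min a (n - a)) (min b (n - b)) = min (n - a) (n - b)" "n - a + (n - b) \<le> n"
    using assms by auto
  thus ?thesis
    using assms card_near_product_pairs_flip[of a n b h, where 'a = 'a]
      card_near_product_pairs_low[of "n - a" "n - b" n h, where 'a = 'a]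
    by simp
qed

lemma covariance_near_factorizations:
  fixes a b h n :: nat
  defines "q \<equiv> real CARD('a::{field, finite})"
  assumes "a \<le> n" "b \<le> n" "h \<le> n"
  shows "(\<Sum>A\<in>(monic_polys_deg n :: 'a poly set).
            (real (card (near_factorizations n h a A)) - q ^ h) *
            (real (card (near_factorizations n h b A)) - q ^ h)) =
         q ^ n * (q ^ h * (1 - 1 / q)) * real (min (min a (n - a)) (min b (n - b)) - h)"
proof -
  let ?M = "monic_polys_deg n :: 'a poly set"
  let ?S = "\<lambda>a A. real (card (near_factorizations n h a A))"
  have first: "(\<Sum>A\<in>?M. ?S c A) = q ^ n * q ^ h" if "c \<le> n" for c
    using sum_card_near_factorizations[OF that assms(4), where 'a = 'a]
    by (simp add: q_def power_add flip: of_nat_sum of_nat_power of_nat_mult)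
  have second: "(\<Sum>A\<in>?M. ?S a A * ?S b A) =
      q ^ h * real (card (near_product_pairs n h a b :: (('a poly \<times> 'a poly) \<times> _) set))"
    using sum_card_near_factorizations_product[OF assms(2-4), where 'a = 'a]
    by (simp add: q_def flip: of_nat_sum of_nat_power of_nat_mult)
  have "(\<Sum>A\<in>?M. (?S a A - q ^ h) * (?S b A - q ^ h)) =
      (\<Sum>A\<in>?M. ?S a A * ?S b A - q ^ h * ?S a A - q ^ h * ?S b A + q ^ h * q ^ h)"
    by (simp add: algebra_simps)
  also have "\<dots> = (\<Sum>A\<in>?M. ?S a A * ?S b A) - q ^ h * (\<Sum>A\<in>?M. ?S a A)
      - q ^ h * (\<Sum>A\<in>?M. ?S b A) + q ^ n * (q ^ h * q ^ h)"
    by (simp add: sum.distrib sum_subtractf sum_distrib_left card_monic_polys_deg q_def)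
  also have "\<dots> = q ^ n * (q ^ h * (1 - 1 / q)) * real (min (min a (n - a)) (min b (n - b)) - h)"
    unfolding second first[OF assms(2)] first[OF assms(3)]
      card_near_product_pairs[OF assms(2-4), where 'a = 'a, folded q_def]
    by (simp add: algebra_simps)
  finally show ?thesis .
qed

section \<open>The sum of the divisor function over a short interval\<close>

lemma short_interval_eq:
  assumes "A \<in> monic_polys_deg n" "h \<le> n"
  shows "short_interval A h = {B \<in> monic_polys_deg n. B - A \<in> low_polys h}"
proof -
  have deg: "deg C < ereal (real h) \<longleftrightarrow> C \<in> low_polys h" for C :: "'a poly"
    by (simp add: deg_def low_polys_iff)
  have "B \<in> monic_polys_deg n" if "B - A \<in> low_polys h" for B
  proof -
    have "A + (B - A) \<in> monic_polys_deg n"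
      using assms that low_polys_mono by (blast intro: monic_polys_deg_add_low)
    thus ?thesis by simp
  qed
  thus ?thesis unfolding short_interval_def deg by (auto simp: monic_polys_deg_def)
qed

text \<open>
  The divisor pairs of the elements of the interval are sorted by the degree of the first divisor
  instead of by their product.
\<close>

lemma sum_divisors_short_interval:
  assumes A: "A \<in> monic_polys_deg n" and h: "h \<le> n"
  shows "(\<Sum>B\<in>short_interval A h. num_monic_divisors B) =
         (\<Sum>a\<le>n. card (near_factorizations n h a A))"
proof -
  let ?D = "\<lambda>B. {(X, Y). X \<in> monic_polys \<and> Y \<in> monic_polys \<and> X * Y = B}"
  have eq: "(\<Union>B\<in>short_interval A h. ?D B) = (\<Union>a\<in>{..n}. near_factorizations n h a A)"
  proof (intro equalityI subsetI)
    fix p assume "p \<in> (\<Union>B\<in>short_interval A h. ?D B)"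
    then obtain X Y where p: "p = (X, Y)" and X: "X \<in> monic_polys_deg (degree X)"
      and XY: "X * Y \<in> monic_polys_deg n" "X * Y - A \<in> low_polys h"
      by (auto simp: short_interval_eq[OF A h] monic_polys_deg_def)
    have "p \<in> near_factorizations n h (degree X) A"
      using monic_polys_deg_cofactor(2)[OF XY(1) X] X XY(2) by (simp add: p near_factorizations_def)
    thus "p \<in> (\<Union>a\<in>{..n}. near_factorizations n h a A)"
      using monic_polys_deg_cofactor(1)[OF XY(1) X] by blast
  next
    fix p assume "p \<in> (\<Union>a\<in>{..n}. near_factorizations n h a A)"
    then obtain a X Y where p: "p = (X, Y)" "a \<le> n" and XY: "X \<in> monic_polys_deg a"
      "Y \<in> monic_polys_deg (n - a)" "X * Y - A \<in> low_polys h"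
      by (auto simp: near_factorizations_def)
    have "X * Y \<in> short_interval A h"
      using monic_polys_deg_mult[OF XY(1,2)] p(2) XY(3) by (simp add: short_interval_eq[OF A h])
    thus "p \<in> (\<Union>B\<in>short_interval A h. ?D B)"
      using XY(1,2) p(1) by (auto simp: monic_polys_deg_def)
  qed
  have fin: "finite (?D B)" if "B \<in> short_interval A h" for B
  proof (rule finite_subset)
    show "?D B \<subseteq> (\<Union>B\<in>short_interval A h. ?D B)" using that by blast
    show "finite (\<Union>B\<in>short_interval A h. ?D B)" unfolding eq by simp
  qed
  have "(\<Sum>B\<in>short_interval A h. num_monic_divisors B) = card (\<Union>B\<in>short_interval A h. ?D B)"
    unfolding num_monic_divisors_def using fin
    by (intro card_UN_disjoint[symmetric]) (auto simp: short_interval_eq[OF A h])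
  also have "\<dots> = (\<Sum>a\<le>n. card (near_factorizations n h a A))"
    unfolding eq
  proof (rule card_UN_disjoint)
    show "\<forall>a\<in>{..n}. \<forall>b\<in>{..n}. a \<noteq> b \<longrightarrow>
        near_factorizations n h a A \<inter> near_factorizations n h b A = {}"
      by (auto simp: near_factorizations_def monic_polys_deg_def)
  qed simp_all
  finally show ?thesis .
qed

text \<open>
  The main term \<open>q ^ h * (n + 1)\<close> gives each of the \<open>n + 1\<close> degrees of the first
  divisor its mean value \<open>q ^ h\<close>.
\<close>

lemma Delta_eq_sum:
  fixes A :: "'a::{field, finite} poly"
  assumes "A \<in> monic_polys_deg n" "h \<le> n"
  shows "Delta A h = (\<Sum>a\<le>n. real (card (near_factorizations n h a A)) - real CARD('a) ^ h)"
proof -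
  have "degree A = n" using assms(1) by (simp add: monic_polys_deg_iff)
  moreover have "(\<Sum>B\<in>short_interval A h. real (num_monic_divisors B)) =
      (\<Sum>a\<le>n. real (card (near_factorizations n h a A)))"
    using sum_divisors_short_interval[OF assms] by (simp flip: of_nat_sum)
  ultimately show ?thesis
    by (simp add: Delta_def sum_subtractf mult.commute)
qed

section \<open>The sum over all pairs of degrees\<close>

lemma sum_squares_step_two:
  fixes n h :: nat
  assumes "2 * h \<le> n"
  shows "(\<Sum>k\<in>{h<..n}. real (card {k..n - k}) ^ 2) =
         (real n - 2 * real h - 1) * (real n - 2 * real h) * (real n - 2 * real h + 1) / 6"
proof -
  define N where "N = (n + 1) div 2"
  \<comment> \<open>The cardinality is \<open>n + 1 - 2 * k\<close> up to \<open>k = N\<close> and \<open>0\<close> afterwards; \<open>f\<close> is an antidifference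
      of its square that vanishes at \<open>N\<close>.\<close>
  define f where "f k = - ((real n - 2 * real k - 1) * (real n - 2 * real k) * (real n - 2 * real k + 1) / 6)"
    for k
  have "(\<Sum>k\<in>{h<..n}. real (card {k..n - k}) ^ 2) = (\<Sum>k\<in>{Suc h..N}. f k - f (k - 1))"
  proof (rule sum.mono_neutral_cong_right)
    fix k assume k: "k \<in> {Suc h..N}"
    hence "real (card {k..n - k}) = real n + 1 - 2 * real k"
      by (auto simp: N_def of_nat_diff)
    moreover have "real (k - 1) = real k - 1" using k by (simp add: of_nat_diff)
    ultimately show "real (card {k..n - k}) ^ 2 = f k - f (k - 1)"
      by (simp add: f_def power2_eq_square field_simps)
  qed (auto simp: N_def)
  also have "\<dots> = f N - f h"
    using assms by (intro sum_telescope'') (simp add: N_def)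
  also have "f N = 0"
  proof -
    have "n = 2 * N \<or> n + 1 = 2 * N" unfolding N_def by presburger
    hence "real n - 2 * real N = 0 \<or> real n - 2 * real N + 1 = 0" by linarith
    thus ?thesis by (auto simp: f_def)
  qed
  finally show ?thesis by (simp add: f_def)
qed

text \<open>
  Layer cake: \<open>t - h\<close> counts the \<open>k > h\<close> with \<open>k \<le> t\<close>. For fixed
  \<open>k\<close> the conditions on \<open>a\<close> and \<open>b\<close> separate, and each of them
  confines its variable to \<open>{k..n - k}\<close>.
\<close>

lemma sum_min_distance_excess:
  fixes n h :: nat
  shows "(\<Sum>a\<le>n. \<Sum>b\<le>n. real (min (min a (n - a)) (min b (n - b)) - h)) =
         (if 2 * h \<le> n
          then (real n - 2 * real h - 1) * (real n - 2 * real h) * (real n - 2 * real h + 1) / 6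
          else 0)"
proof -
  let ?m = "\<lambda>a. min a (n - a)"
  have layer: "real (t - h) = (\<Sum>k\<in>{h<..n}. of_bool (k \<le> t))" if "t \<le> n" for t
  proof -
    have "real (t - h) = real (max h t) - real h" by (simp add: max_def)
    also have "\<dots> = (\<Sum>k\<in>{h<..n}. of_bool (k \<le> t) * (real k - real (k - 1)))"
      using max_telescope[OF that, of real h] by simp
    also have "\<dots> = (\<Sum>k\<in>{h<..n}. of_bool (k \<le> t))"
      by (intro sum.cong) (auto simp: of_nat_diff)
    finally show ?thesis .
  qed
  have "(\<Sum>a\<le>n. \<Sum>b\<le>n. real (min (?m a) (?m b) - h)) =
      (\<Sum>a\<le>n. \<Sum>b\<le>n. \<Sum>k\<in>{h<..n}. of_bool (k \<le> ?m a) * of_bool (k \<le> ?m b))"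
  proof (intro sum.cong refl)
    fix a b assume "a \<in> {..n}" "b \<in> {..n}"
    hence "min (?m a) (?m b) \<le> n" by auto
    thus "real (min (?m a) (?m b) - h) =
        (\<Sum>k\<in>{h<..n}. of_bool (k \<le> ?m a) * of_bool (k \<le> ?m b))"
      by (simp only: layer min.bounded_iff of_bool_conj)
  qed
  also have "\<dots> = (\<Sum>a\<le>n. \<Sum>k\<in>{h<..n}. \<Sum>b\<le>n. of_bool (k \<le> ?m a) * of_bool (k \<le> ?m b))"
    by (intro sum.cong refl sum.swap)
  also have "\<dots> = (\<Sum>k\<in>{h<..n}. \<Sum>a\<le>n. \<Sum>b\<le>n. of_bool (k \<le> ?m a) * of_bool (k \<le> ?m b))"
    by (rule sum.swap)
  also have "\<dots> = (\<Sum>k\<in>{h<..n}. (\<Sum>a\<le>n. of_bool (k \<le> ?m a)) ^ 2)"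
    by (simp only: power2_eq_square sum_product)
  also have "\<dots> = (\<Sum>k\<in>{h<..n}. real (card {k..n - k}) ^ 2)"
  proof (rule sum.cong[OF refl])
    fix k
    have "(\<Sum>a\<le>n. of_bool (k \<le> ?m a)) = real (card ({..n} \<inter> {a. k \<le> ?m a}))"
      by (simp add: sum_of_bool_eq)
    also have "{..n} \<inter> {a. k \<le> ?m a} = {k..n - k}" by auto
    finally show "(\<Sum>a\<le>n. of_bool (k \<le> ?m a)) ^ 2 = real (card {k..n - k}) ^ 2" by simp
  qed
  also have "\<dots> = (if 2 * h \<le> n
          then (real n - 2 * real h - 1) * (real n - 2 * real h) * (real n - 2 * real h + 1) / 6
          else 0)"
    using sum_squares_step_two[of h n] by (auto intro!: sum.neutral)
  finally show ?thesis .
qed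

section \<open>The variance\<close>

theorem theorem1p2p1:
  fixes q n h :: nat
  assumes "CARD('a::{field, finite}) = q"
    and "n \<ge> 4"
    and "h \<le> n"
  shows "1 / real q ^ n * (\<Sum>A\<in>(monic_polys_deg n :: 'a poly set). \<bar>Delta A h\<bar> ^ 2) =
    (if h \<le> n div 2 - 1
     then (real q - 1) * real q powi (int h - 1)
            * ((real n - 2 * real h - 1) * (real n - 2 * real h) * (real n - 2 * real h + 1) / 6)
     else 0)"
proof -
  let ?M = "monic_polys_deg n :: 'a poly set"
  let ?S = "\<lambda>a A. real (card (near_factorizations n h a A)) - real q ^ h"
  have q: "real q > 0" using assms(1) by auto
  have "(\<Sum>A\<in>?M. \<bar>Delta A h\<bar> ^ 2) = (\<Sum>A\<in>?M. \<Sum>a\<le>n. \<Sum>b\<le>n. ?S a A * ?S b A)"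
    using Delta_eq_sum[OF _ assms(3), where 'a = 'a] assms(1)
    by (intro sum.cong refl) (simp add: power2_eq_square sum_product)
  also have "\<dots> = (\<Sum>a\<le>n. \<Sum>b\<le>n. \<Sum>A\<in>?M. ?S a A * ?S b A)"
    by (subst sum.swap, rule sum.cong[OF refl], rule sum.swap)
  also have "\<dots> = (\<Sum>a\<le>n. \<Sum>b\<le>n. real q ^ n * (real q ^ h * (1 - 1 / real q)) *
      real (min (min a (n - a)) (min b (n - b)) - h))"
    using covariance_near_factorizations[where 'a = 'a and n = n and h = h] assms
    by (intro sum.cong refl) auto
  also have "\<dots> = real q ^ n * (real q ^ h * (1 - 1 / real q)) *
      (\<Sum>a\<le>n. \<Sum>b\<le>n. real (min (min a (n - a)) (min b (n - b)) - h))"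
    by (simp only: sum_distrib_left)
  finally have "1 / real q ^ n * (\<Sum>A\<in>?M. \<bar>Delta A h\<bar> ^ 2) = (real q ^ h * (1 - 1 / real q)) *
      (if 2 * h \<le> n
       then (real n - 2 * real h - 1) * (real n - 2 * real h) * (real n - 2 * real h + 1) / 6
       else 0)"
    using q unfolding sum_min_distance_excess by simp
  also have "real q ^ h * (1 - 1 / real q) = (real q - 1) * real q powi (int h - 1)"
    using q by (simp add: power_int_diff field_simps)
  \<comment> \<open>The two conditions differ for \<open>h = n div 2\<close>, where \<open>n - 2 * h\<close> is \<open>0\<close> or \<open>1\<close> and the product
      vanishes.\<close>
  also have "(if 2 * h \<le> n
       then (real n - 2 * real h - 1) * (real n - 2 * real h) * (real n - 2 * real h + 1) / 6
       else 0) =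
     (if h \<le> n div 2 - 1
      then (real n - 2 * real h - 1) * (real n - 2 * real h) * (real n - 2 * real h + 1) / 6
      else 0)"
  proof (cases "h \<le> n div 2 - 1 \<or> \<not> 2 * h \<le> n")
    case True
    moreover have "2 * h \<le> n" if "h \<le> n div 2 - 1" using that assms(2) by linarith
    ultimately show ?thesis by auto
  next
    case False
    hence "n = 2 * h \<or> n = 2 * h + 1" using assms(2) by linarith
    thus ?thesis using False by auto
  qed
  finally show ?thesis by simp
qed

end
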